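(* Let $\mathbb{T}=\mathbb{S}^1\times\mathbb{S}^1$ with its standard flat product metric, let $k_1,k_2,l_1,l_2\in\mathbb{Z}$, and let $\phi:\mathbb{T}\to\mathbb{S}^3$ be the map given in standard angular coordinates $(u,v)$ by $$\phi(u,v)=\frac{1}{\sqrt2}\left(\cos(k_1u+k_2v),\ \sin(k_1u+k_2v),\ \cos(l_1u+l_2v),\ \sin(l_1u+l_2v)\right)\in\mathbb{S}^3\subset\mathbb{R}^4 .$$ Then $\phi$ is proper biharmonic if and only if $l_1^2+l_2^2\neq k_1^2+k_2^2$.
   Context: $\mathbb{S}^3$ is the unit sphere of $\mathbb{R}^4$ with its round metric; $\mathbb{T}$ carries the metric $du^2+dv^2$, where $u,v$ are $2\pi$-periodic angular coordinates on the two unit circles. (The map $\phi$ is $\Psi\circ G$, where $\Psi(s,t)=\frac{1}{\sqrt2}(\cos s,\sin s,\cos t,\sin t)$ and $G:\mathbb{T}\to\mathbb{T}$, $G(u,v)=(k_1u+k_2v,\,l_1u+l_2v)$.) For a smooth map $\phi:(M,g)\to(N,h)$ between Riemannian manifolds, the tension field is $\tau(\phi)=\operatorname{trace}\nabla d\phi$ and the bitension field is $\tau_2(\phi)=-\Delta\tau(\phi)-\operatorname{trace}R^N(d\phi(\cdot),\tau(\phi))d\phi(\cdot)$, where $\Delta\sigma=-\operatorname{trace}_g\nabla^2\sigma$ is the rough Laplacian on sections of $\phi^{-1}TN$ and $R(X,Y)Z=\nabla_X\nabla_YZ-\nabla_Y\nabla_XZ-\nabla_{[X,Y]}Z$. The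 map $\phi$ is harmonic if $\tau(\phi)=0$, biharmonic if $\tau_2(\phi)=0$, and proper biharmonic if it is biharmonic and not harmonic. *)

theory Defs
  imports "HOL-Analysis.Analysis"
begin

text \<open>
  Riemannian manifolds are represented as smooth embedded submanifolds \<open>M\<close> of a Euclidean space,
  with the metric induced by the ambient inner product.  This covers the round sphere
  \<open>sphere 0 1\<close> in \<open>real ^ 4\<close> and the flat torus \<open>sphere 0 1 \<times> sphere 0 1\<close> in
  \<open>complex \<times> complex\<close>, whose induced metric in the angular coordinates
  \<open>(u, v) \<mapsto> (cis u, cis v)\<close> is \<open>du\<^sup>2 + dv\<^sup>2\<close> (lemma \<open>torus_induced_metric\<close>).
  Vector fields and sections are functions on the ambient space of which only the values on \<open>M\<close>
  matter.
\<close>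

subsection \<open>Tangent vectors, derivatives and smooth maps\<close>

definition tangent_space :: "'a::euclidean_space set \<Rightarrow> 'a \<Rightarrow> 'a set" where
  "tangent_space M p =
    {v. \<exists>\<gamma>::real \<Rightarrow> 'a. \<gamma> 0 = p \<and> (\<forall>t. \<gamma> t \<in> M) \<and> (\<gamma> has_vector_derivative v) (at 0)}"

definition tangent_proj :: "'a::euclidean_space set \<Rightarrow> 'a \<Rightarrow> 'a \<Rightarrow> 'a" where
  "tangent_proj M p v =
    (THE w. w \<in> tangent_space M p \<and> (\<forall>z\<in>tangent_space M p. orthogonal (v - w) z))"

text \<open>
  The derivative within \<open>M\<close> is not unique as a linear map on the ambient space, but its values on
  tangent vectors are (lemma \<open>differential_eq\<close>); it is only ever applied to those.
\<close>

definition differential ::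
  "'a::euclidean_space set \<Rightarrow> ('a \<Rightarrow> 'b::euclidean_space) \<Rightarrow> 'a \<Rightarrow> 'a \<Rightarrow> 'b" where
  "differential M f p v = frechet_derivative f (at p within M) v"

primrec Ck_on ::
  "nat \<Rightarrow> 'a::euclidean_space set \<Rightarrow> ('a \<Rightarrow> 'b::euclidean_space) \<Rightarrow> bool" where
  "Ck_on 0 U f \<longleftrightarrow> continuous_on U f"
| "Ck_on (Suc k) U f \<longleftrightarrow>
    (\<forall>x\<in>U. f differentiable (at x)) \<and> (\<forall>v. Ck_on k U (\<lambda>x. frechet_derivative f (at x) v))"

definition smooth_map ::
  "'a::euclidean_space set \<Rightarrow> 'b::euclidean_space set \<Rightarrow> ('a \<Rightarrow> 'b) \<Rightarrow> bool" where
  "smooth_map M N \<phi> \<longleftrightarrow>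
    \<phi> ` M \<subseteq> N \<and>
    (\<forall>p\<in>M. \<exists>U F. open U \<and> p \<in> U \<and> (\<forall>k. Ck_on k U F) \<and> (\<forall>q\<in>U \<inter> M. F q = \<phi> q))"

subsection \<open>Connections\<close>

text \<open>
  For a map \<open>\<phi>\<close> from \<open>M\<close> to \<open>N\<close> and a section \<open>\<sigma>\<close> of \<open>\<phi>\<^sup>-\<^sup>1TN\<close>, \<open>cov_deriv M N \<phi> \<sigma> p v\<close> is
  \<open>\<nabla>\<^sub>v \<sigma>\<close> for the pull-back of the Levi-Civita connection of the induced metric on \<open>N\<close>, given as
  the tangential part of the ambient derivative.  The Levi-Civita connection itself is the case
  \<open>\<phi> = id\<close>.  Lemmas \<open>cov_deriv_metric\<close>, \<open>levi_civita_torsion_free_sphere\<close>,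
  \<open>levi_civita_torsion_free_torus\<close> and \<open>cov_deriv_pullback\<close> record the characteristic properties.
\<close>

definition cov_deriv ::
  "'a::euclidean_space set \<Rightarrow> 'b::euclidean_space set \<Rightarrow> ('a \<Rightarrow> 'b) \<Rightarrow> ('a \<Rightarrow> 'b) \<Rightarrow> 'a \<Rightarrow> 'a \<Rightarrow> 'b"
  where "cov_deriv M N \<phi> \<sigma> p v = tangent_proj N (\<phi> p) (differential M \<sigma> p v)"

definition levi_civita :: "'a::euclidean_space set \<Rightarrow> ('a \<Rightarrow> 'a) \<Rightarrow> 'a \<Rightarrow> 'a \<Rightarrow> 'a" where
  "levi_civita M Y p v = cov_deriv M M (\<lambda>q. q) Y p v"

definition lie_bracket ::
  "'a::euclidean_space set \<Rightarrow> ('a \<Rightarrow> 'a) \<Rightarrow> ('a \<Rightarrow> 'a) \<Rightarrow> 'a \<Rightarrow> 'a" where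
  "lie_bracket M X Y p = differential M Y p (X p) - differential M X p (Y p)"

text \<open>
  A vector field on \<open>M\<close> through a given tangent vector.  The tensors below are computed by extending
  their arguments to vector fields; being tensors, they do not depend on the extension.
\<close>

definition extend_tangent :: "'a::euclidean_space set \<Rightarrow> 'a \<Rightarrow> 'a \<Rightarrow> 'a" where
  "extend_tangent M v q = tangent_proj M q v"

definition curvature :: "'a::euclidean_space set \<Rightarrow> 'a \<Rightarrow> 'a \<Rightarrow> 'a \<Rightarrow> 'a \<Rightarrow> 'a" where
  "curvature N p x y z =
    (let X = extend_tangent N x; Y = extend_tangent N y; Z = extend_tangent N z in
      levi_civita N (\<lambda>q. levi_civita N Z q (Y q)) p (X p)
      - levi_civita N (\<lambda>q. levi_civita N Z q (X q)) p (Y p)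
      - levi_civita N Z p (lie_bracket N X Y p))"

subsection \<open>Tension and bitension fields\<close>

text \<open>\<open>(\<nabla>d\<phi>)(v, w) = \<nabla>\<^sub>v (d\<phi> W) - d\<phi> (\<nabla>\<^sub>v W)\<close> at \<open>p\<close>, for a vector field \<open>W\<close> with value \<open>w\<close> at \<open>p\<close>.\<close>

definition nabla_differential ::
  "'a::euclidean_space set \<Rightarrow> 'b::euclidean_space set \<Rightarrow> ('a \<Rightarrow> 'b) \<Rightarrow> 'a \<Rightarrow> 'a \<Rightarrow> 'a \<Rightarrow> 'b" where
  "nabla_differential M N \<phi> p v w =
    (let W = extend_tangent M w in
      cov_deriv M N \<phi> (\<lambda>q. differential M \<phi> q (W q)) p v
      - differential M \<phi> p (levi_civita M W p v))"

text \<open>\<open>(\<nabla>\<^sup>2\<sigma>)(v, w) = \<nabla>\<^sub>v (\<nabla>\<^sub>W \<sigma>) - \<nabla>\<^bsub>\<nabla>\<^sub>v W\<^esub> \<sigma>\<close> at \<open>p\<close>, for a vector field \<open>W\<close> with value \<open>w\<close> at \<open>p\<close>.\<close>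

definition second_cov_deriv ::
  "'a::euclidean_space set \<Rightarrow> 'b::euclidean_space set \<Rightarrow> ('a \<Rightarrow> 'b) \<Rightarrow> ('a \<Rightarrow> 'b) \<Rightarrow> 'a \<Rightarrow> 'a \<Rightarrow> 'a \<Rightarrow> 'b"
  where
  "second_cov_deriv M N \<phi> \<sigma> p v w =
    (let W = extend_tangent M w in
      cov_deriv M N \<phi> (\<lambda>q. cov_deriv M N \<phi> \<sigma> q (W q)) p v
      - cov_deriv M N \<phi> \<sigma> p (levi_civita M W p v))"

definition orthonormal_basis :: "'a::euclidean_space set \<Rightarrow> 'a set \<Rightarrow> bool" where
  "orthonormal_basis V E \<longleftrightarrow> pairwise orthogonal E \<and> (\<forall>e\<in>E. norm e = 1) \<and> span E = V"

definition metric_trace ::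
  "'a::euclidean_space set \<Rightarrow> 'a \<Rightarrow> ('a \<Rightarrow> 'a \<Rightarrow> 'b::euclidean_space) \<Rightarrow> 'b" where
  "metric_trace M p B = (\<Sum>e\<in>(SOME E. orthonormal_basis (tangent_space M p) E). B e e)"

definition tension ::
  "'a::euclidean_space set \<Rightarrow> 'b::euclidean_space set \<Rightarrow> ('a \<Rightarrow> 'b) \<Rightarrow> 'a \<Rightarrow> 'b" where
  "tension M N \<phi> p = metric_trace M p (nabla_differential M N \<phi> p)"

definition rough_laplacian ::
  "'a::euclidean_space set \<Rightarrow> 'b::euclidean_space set \<Rightarrow> ('a \<Rightarrow> 'b) \<Rightarrow> ('a \<Rightarrow> 'b) \<Rightarrow> 'a \<Rightarrow> 'b" where
  "rough_laplacian M N \<phi> \<sigma> p = - metric_trace M p (second_cov_deriv M N \<phi> \<sigma> p)"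

definition bitension ::
  "'a::euclidean_space set \<Rightarrow> 'b::euclidean_space set \<Rightarrow> ('a \<Rightarrow> 'b) \<Rightarrow> 'a \<Rightarrow> 'b" where
  "bitension M N \<phi> p =
    - rough_laplacian M N \<phi> (tension M N \<phi>) p
    - metric_trace M p (\<lambda>v w.
        curvature N (\<phi> p) (differential M \<phi> p v) (tension M N \<phi> p) (differential M \<phi> p w))"

definition harmonic ::
  "'a::euclidean_space set \<Rightarrow> 'b::euclidean_space set \<Rightarrow> ('a \<Rightarrow> 'b) \<Rightarrow> bool" where
  "harmonic M N \<phi> \<longleftrightarrow> smooth_map M N \<phi> \<and> (\<forall>p\<in>M. tension M N \<phi> p = 0)"

definition biharmonic ::
  "'a::euclidean_space set \<Rightarrow> 'b::euclidean_space set \<Rightarrow> ('a \<Rightarrow> 'b) \<Rightarrow> bool" where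
  "biharmonic M N \<phi> \<longleftrightarrow> smooth_map M N \<phi> \<and> (\<forall>p\<in>M. bitension M N \<phi> p = 0)"

definition proper_biharmonic ::
  "'a::euclidean_space set \<Rightarrow> 'b::euclidean_space set \<Rightarrow> ('a \<Rightarrow> 'b) \<Rightarrow> bool" where
  "proper_biharmonic M N \<phi> \<longleftrightarrow> biharmonic M N \<phi> \<and> \<not> harmonic M N \<phi>"

subsection \<open>Consistency of the definitions\<close>

lemma vector_4 [simp]:
  "(vector [x, y, z, w] :: 'a::zero ^ 4) $ 1 = x"
  "(vector [x, y, z, w] :: 'a::zero ^ 4) $ 2 = y"
  "(vector [x, y, z, w] :: 'a::zero ^ 4) $ 3 = z"
  "(vector [x, y, z, w] :: 'a::zero ^ 4) $ 4 = w"
  unfolding vector_def by simp_all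

lemma differential_eq:
  assumes f: "(f has_derivative D) (at p within M)" and v: "v \<in> tangent_space M p"
  shows "differential M f p v = D v"
proof -
  obtain \<gamma> :: "real \<Rightarrow> _" where g: "\<gamma> 0 = p" "\<And>t. \<gamma> t \<in> M" "(\<gamma> has_vector_derivative v) (at 0)"
    using v unfolding tangent_space_def by auto
  have *: "((f \<circ> \<gamma>) has_vector_derivative D' v) (at 0)"
    if D': "(f has_derivative D') (at p within M)" for D'
  proof -
    have "(f has_derivative D') (at (\<gamma> 0) within range \<gamma>)"
      using D' g(1,2) by (auto intro: has_derivative_subset)
    then have "((f \<circ> \<gamma>) has_derivative D' \<circ> (\<lambda>t. t *\<^sub>R v)) (at 0)"
      using g(3) unfolding has_vector_derivative_def by (intro diff_chain_within) auto
    moreover have "D' \<circ> (\<lambda>t. t *\<^sub>R v) = (\<lambda>t. t *\<^sub>R D' v)"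
      using has_derivative_bounded_linear[OF D']
      by (auto simp: fun_eq_iff linear_simps)
    ultimately show ?thesis
      unfolding has_vector_derivative_def by simp
  qed
  have "f differentiable (at p within M)"
    using f by (rule differentiableI)
  then have "(f has_derivative frechet_derivative f (at p within M)) (at p within M)"
    by (simp add: frechet_derivative_works)
  from vector_derivative_unique_at[OF *[OF this] *[OF f]] show ?thesis
    by (simp add: differential_def)
qed

lemma tangent_proj_ex1:
  assumes "subspace (tangent_space M p)"
  shows "\<exists>!w. w \<in> tangent_space M p \<and> (\<forall>z\<in>tangent_space M p. orthogonal (v - w) z)"
proof (rule ex_ex1I)
  obtain y z where "y \<in> span (tangent_space M p)"
    "\<And>w. w \<in> span (tangent_space M p) \<Longrightarrow> orthogonal z w" "v = y + z"
    using orthogonal_subspace_decomp_exists[of "tangent_space M p" v] by metis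
  then show "\<exists>w. w \<in> tangent_space M p \<and> (\<forall>z\<in>tangent_space M p. orthogonal (v - w) z)"
    using span_eq_iff[THEN iffD2, OF assms] by (intro exI[of _ y]) simp
next
  fix w w'
  assume w: "w \<in> tangent_space M p \<and> (\<forall>z\<in>tangent_space M p. orthogonal (v - w) z)"
    and w': "w' \<in> tangent_space M p \<and> (\<forall>z\<in>tangent_space M p. orthogonal (v - w') z)"
  have "w - w' \<in> tangent_space M p"
    using w w' assms by (simp add: subspace_diff)
  then have "(w - w') \<bullet> (w - w') = 0"
    using w w' by (simp add: orthogonal_def inner_diff_left)
  then show "w = w'"
    by simp
qed

lemma
  assumes "subspace (tangent_space M p)"
  shows tangent_proj_in: "tangent_proj M p v \<in> tangent_space M p"
    and tangent_proj_inner: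
      "z \<in> tangent_space M p \<Longrightarrow> tangent_proj M p v \<bullet> z = v \<bullet> z"
  using theI'[OF tangent_proj_ex1[OF assms, of v]]
  by (auto simp: tangent_proj_def orthogonal_def inner_diff_left)

lemma tangent_proj_unique:
  assumes "subspace (tangent_space M p)" "w \<in> tangent_space M p"
    "\<And>z. z \<in> tangent_space M p \<Longrightarrow> w \<bullet> z = v \<bullet> z"
  shows "tangent_proj M p v = w"
  unfolding tangent_proj_def
  using assms by (intro the1_equality tangent_proj_ex1) (auto simp: orthogonal_def inner_diff_left)

lemma cov_deriv_metric:
  assumes "subspace (tangent_space N (\<phi> p))" and v: "v \<in> tangent_space M p"
    and "\<sigma> p \<in> tangent_space N (\<phi> p)" "\<rho> p \<in> tangent_space N (\<phi> p)"
    and "\<sigma> differentiable (at p within M)" "\<rho> differentiable (at p within M)"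
  shows "differential M (\<lambda>q. \<sigma> q \<bullet> \<rho> q) p v =
    cov_deriv M N \<phi> \<sigma> p v \<bullet> \<rho> p + \<sigma> p \<bullet> cov_deriv M N \<phi> \<rho> p v"
proof -
  have "((\<lambda>q. \<sigma> q \<bullet> \<rho> q) has_derivative
      (\<lambda>h. \<sigma> p \<bullet> differential M \<rho> p h + differential M \<sigma> p h \<bullet> \<rho> p)) (at p within M)"
    using assms(5,6) unfolding differential_def frechet_derivative_works
    by (rule has_derivative_inner)
  from differential_eq[OF this v] show ?thesis
    using assms by (simp add: cov_deriv_def tangent_proj_inner inner_commute[of "\<sigma> p"])
qed

lemma differential_in_tangent_space:
  assumes "\<phi> ` M \<subseteq> N" "\<phi> differentiable (at p within M)" "v \<in> tangent_space M p"
  shows "differential M \<phi> p v \<in> tangent_space N (\<phi> p)"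
proof -
  obtain \<gamma> :: "real \<Rightarrow> _" where g: "\<gamma> 0 = p" "\<And>t. \<gamma> t \<in> M" "(\<gamma> has_vector_derivative v) (at 0)"
    using assms(3) unfolding tangent_space_def by auto
  let ?D = "frechet_derivative \<phi> (at p within M)"
  have D: "(\<phi> has_derivative ?D) (at p within M)"
    using assms(2) by (simp add: frechet_derivative_works)
  have "(\<phi> has_derivative ?D) (at (\<gamma> 0) within range \<gamma>)"
    using D g(1,2) by (auto intro: has_derivative_subset)
  then have "((\<phi> \<circ> \<gamma>) has_derivative ?D \<circ> (\<lambda>t. t *\<^sub>R v)) (at 0)"
    using g(3) unfolding has_vector_derivative_def by (intro diff_chain_within) auto
  moreover have "?D \<circ> (\<lambda>t. t *\<^sub>R v) = (\<lambda>t. t *\<^sub>R ?D v)"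
    using has_derivative_bounded_linear[OF D] by (auto simp: fun_eq_iff linear_simps)
  ultimately have "((\<phi> \<circ> \<gamma>) has_vector_derivative ?D v) (at 0)"
    unfolding has_vector_derivative_def by simp
  then show ?thesis
    unfolding tangent_space_def differential_def
    using assms(1) g(1,2) by (auto intro!: exI[of _ "\<phi> \<circ> \<gamma>"])
qed

lemma cov_deriv_pullback:
  assumes "\<phi> ` M \<subseteq> N" "\<phi> differentiable (at p within M)" "v \<in> tangent_space M p"
    and "V differentiable (at (\<phi> p) within N)"
  shows "cov_deriv M N \<phi> (V \<circ> \<phi>) p v = levi_civita N V (\<phi> p) (differential M \<phi> p v)"
proof -
  have "(V has_derivative differential N V (\<phi> p)) (at (\<phi> p) within \<phi> ` M)"
    using assms(1,4) unfolding differential_def frechet_derivative_works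
    by (rule has_derivative_subset[rotated])
  moreover have "(\<phi> has_derivative differential M \<phi> p) (at p within M)"
    using assms(2) unfolding differential_def frechet_derivative_works .
  ultimately have
    "(V \<circ> \<phi> has_derivative differential N V (\<phi> p) \<circ> differential M \<phi> p) (at p within M)"
    by (intro diff_chain_within)
  from differential_eq[OF this assms(3)] show ?thesis
    by (simp add: cov_deriv_def levi_civita_def)
qed

lemma tangent_space_sphere:
  fixes p :: "'a::euclidean_space"
  assumes p: "norm p = 1"
  shows "tangent_space (sphere 0 1) p = {v. v \<bullet> p = 0}"
proof (intro set_eqI iffI; (elim CollectE)?)
  fix v assume "v \<in> tangent_space (sphere 0 1) p"
  then obtain \<gamma> :: "real \<Rightarrow> 'a" where
    g: "\<gamma> 0 = p" "\<And>t. \<gamma> t \<in> sphere 0 1" "(\<gamma> has_vector_derivative v) (at 0)"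
    unfolding tangent_space_def by auto
  have "\<gamma> t \<bullet> \<gamma> t = 1" for t
    using g(2)[of t] by (simp add: dot_square_norm)
  moreover have "((\<lambda>t. \<gamma> t \<bullet> \<gamma> t) has_derivative (\<lambda>h. \<gamma> 0 \<bullet> (h *\<^sub>R v) + (h *\<^sub>R v) \<bullet> \<gamma> 0)) (at 0)"
    using g(3) unfolding has_vector_derivative_def by (intro has_derivative_inner)
  ultimately have "((\<lambda>t. 1::real) has_derivative (\<lambda>h. \<gamma> 0 \<bullet> (h *\<^sub>R v) + (h *\<^sub>R v) \<bullet> \<gamma> 0)) (at 0)"
    by simp
  from has_derivative_unique[OF this has_derivative_const]
  have "\<gamma> 0 \<bullet> (1 *\<^sub>R v) + (1 *\<^sub>R v) \<bullet> \<gamma> 0 = 0"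
    by metis
  then show "v \<in> {v. v \<bullet> p = 0}"
    using g(1) by (simp add: inner_commute)
next
  fix v assume vp: "v \<bullet> p = 0"
  define r where "r = norm v"
  define \<gamma> where "\<gamma> = (\<lambda>t::real. cos (r * t) *\<^sub>R p + sin (r * t) *\<^sub>R sgn v)"
  have "norm (\<gamma> t) = 1" for t
  proof (cases "v = 0")
    case False
    have "p \<bullet> p = 1" "sgn v \<bullet> sgn v = 1" "sgn v \<bullet> p = 0" "p \<bullet> sgn v = 0"
      using p vp False by (simp_all add: dot_square_norm norm_sgn sgn_div_norm inner_commute)
    then have "\<gamma> t \<bullet> \<gamma> t = 1"
      by (simp add: \<gamma>_def inner_add_left inner_add_right flip: power2_eq_square)
    then show ?thesis
      by (simp add: norm_eq_sqrt_inner)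
  qed (simp add: \<gamma>_def r_def p)
  moreover have "(\<gamma> has_vector_derivative v) (at 0)"
  proof -
    have "(\<gamma> has_vector_derivative (- sin (r * 0) * r) *\<^sub>R p + (cos (r * 0) * r) *\<^sub>R sgn v) (at 0)"
      unfolding \<gamma>_def has_vector_derivative_def
      by (auto intro!: derivative_eq_intros simp: algebra_simps)
    then show ?thesis
      by (cases "v = 0") (simp_all add: r_def sgn_div_norm)
  qed
  ultimately show "v \<in> tangent_space (sphere 0 1) p"
    unfolding tangent_space_def by (auto intro!: exI[of _ \<gamma>] simp: \<gamma>_def)
qed

lemma tangent_space_Times:
  "tangent_space (A \<times> B) (p, q) = tangent_space A p \<times> tangent_space B q"
proof (intro set_eqI iffI)
  fix x assume "x \<in> tangent_space (A \<times> B) (p, q)"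
  then obtain \<gamma> :: "real \<Rightarrow> _" where
    g: "\<gamma> 0 = (p, q)" "\<And>t. \<gamma> t \<in> A \<times> B" "(\<gamma> has_vector_derivative x) (at 0)"
    unfolding tangent_space_def by auto
  have "((\<lambda>t. fst (\<gamma> t)) has_vector_derivative fst x) (at 0)"
    "((\<lambda>t. snd (\<gamma> t)) has_vector_derivative snd x) (at 0)"
    using has_derivative_fst[OF g(3)[unfolded has_vector_derivative_def]]
      has_derivative_snd[OF g(3)[unfolded has_vector_derivative_def]]
    by (simp_all add: has_vector_derivative_def)
  moreover have "fst (\<gamma> t) \<in> A" "snd (\<gamma> t) \<in> B" for t
    using g(2)[of t] by (auto simp: mem_Times_iff)
  ultimately have "fst x \<in> tangent_space A p" "snd x \<in> tangent_space B q"
    unfolding tangent_space_def using g(1)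
    by (auto intro!: exI[of _ "\<lambda>t. fst (\<gamma> t)"] exI[of _ "\<lambda>t. snd (\<gamma> t)"])
  then show "x \<in> tangent_space A p \<times> tangent_space B q"
    by (simp add: mem_Times_iff)
next
  fix x assume "x \<in> tangent_space A p \<times> tangent_space B q"
  then obtain \<alpha> \<beta> :: "real \<Rightarrow> _" where
    "\<alpha> 0 = p" "\<And>t. \<alpha> t \<in> A" "(\<alpha> has_vector_derivative fst x) (at 0)"
    "\<beta> 0 = q" "\<And>t. \<beta> t \<in> B" "(\<beta> has_vector_derivative snd x) (at 0)"
    unfolding tangent_space_def by auto
  then show "x \<in> tangent_space (A \<times> B) (p, q)"
    unfolding tangent_space_def
    using has_vector_derivative_Pair[of \<alpha> "fst x" 0 UNIV \<beta> "snd x"]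
    by (auto intro!: exI[of _ "\<lambda>t. (\<alpha> t, \<beta> t)"])
qed

lemma subspace_tangent_sphere:
  assumes "p \<in> sphere (0::'a::euclidean_space) 1"
  shows "subspace (tangent_space (sphere 0 1) p)"
  using assms by (simp add: tangent_space_sphere subspace_def inner_add_left)

lemma subspace_tangent_torus:
  assumes "p \<in> sphere (0::'a::euclidean_space) 1 \<times> sphere (0::'b::euclidean_space) 1"
  shows "subspace (tangent_space (sphere 0 1 \<times> sphere 0 1) p)"
  using assms by (cases p) (auto simp: tangent_space_Times intro!: subspace_Times subspace_tangent_sphere)

lemma lie_bracket_normal:
  fixes A :: "'a::euclidean_space \<Rightarrow> 'a"
  assumes A: "bounded_linear A" "\<And>x y. A x \<bullet> y = x \<bullet> A y"
    and N: "\<And>q v. q \<in> N \<Longrightarrow> v \<in> tangent_space N q \<Longrightarrow> v \<bullet> A q = 0"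
    and XY: "\<And>q. q \<in> N \<Longrightarrow> X q \<in> tangent_space N q" "\<And>q. q \<in> N \<Longrightarrow> Y q \<in> tangent_space N q"
    and d: "X differentiable (at p within N)" "Y differentiable (at p within N)" and p: "p \<in> N"
  shows "lie_bracket N X Y p \<bullet> A p = 0"
proof -
  have *: "differential N V p w \<bullet> A p = - (V p \<bullet> A w)"
    if V: "V differentiable (at p within N)" "\<And>q. q \<in> N \<Longrightarrow> V q \<in> tangent_space N q"
      and w: "w \<in> tangent_space N p" for V w
  proof -
    have "((\<lambda>q. V q \<bullet> A q) has_derivative (\<lambda>h. V p \<bullet> A h + differential N V p h \<bullet> A p)) (at p within N)"
      using V(1) unfolding differential_def frechet_derivative_works
      by (intro has_derivative_inner bounded_linear_imp_has_derivative[OF A(1)])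
    then have 1: "differential N (\<lambda>q. V q \<bullet> A q) p w = V p \<bullet> A w + differential N V p w \<bullet> A p"
      using w by (rule differential_eq)
    have "((\<lambda>q. V q \<bullet> A q) has_derivative (\<lambda>h. 0)) (at p within N)"
      by (rule has_derivative_transform[OF p _ has_derivative_const[of 0]]) (use V(2) N in auto)
    then have "differential N (\<lambda>q. V q \<bullet> A q) p w = 0"
      using w by (rule differential_eq)
    with 1 show ?thesis
      by simp
  qed
  show ?thesis
    using *[OF d(2) XY(2) XY(1)[OF p]] *[OF d(1) XY(1) XY(2)[OF p]] A(2)[of "X p" "Y p"]
    by (simp add: lie_bracket_def inner_diff_left inner_diff_right inner_commute)
qed

lemma levi_civita_torsion_free:
  assumes "subspace (tangent_space N p)" "lie_bracket N X Y p \<in> tangent_space N p"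
  shows "levi_civita N Y p (X p) - levi_civita N X p (Y p) = lie_bracket N X Y p"
proof -
  have "tangent_proj N p (lie_bracket N X Y p)
      = tangent_proj N p (differential N Y p (X p)) - tangent_proj N p (differential N X p (Y p))"
    using assms(1)
    by (intro tangent_proj_unique)
      (auto simp: tangent_proj_in tangent_proj_inner subspace_diff inner_diff_left lie_bracket_def)
  moreover have "tangent_proj N p (lie_bracket N X Y p) = lie_bracket N X Y p"
    using assms by (intro tangent_proj_unique) auto
  ultimately show ?thesis
    by (simp add: levi_civita_def cov_deriv_def)
qed

lemma levi_civita_torsion_free_sphere:
  fixes X Y :: "'a::euclidean_space \<Rightarrow> 'a"
  defines "N \<equiv> sphere (0::'a) 1"
  assumes "\<And>q. q \<in> N \<Longrightarrow> X q \<in> tangent_space N q" "\<And>q. q \<in> N \<Longrightarrow> Y q \<in> tangent_space N q"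
    and "X differentiable (at p within N)" "Y differentiable (at p within N)" and p: "p \<in> N"
  shows "levi_civita N Y p (X p) - levi_civita N X p (Y p) = lie_bracket N X Y p"
proof (rule levi_civita_torsion_free)
  have "lie_bracket N X Y p \<bullet> p = 0"
    by (rule lie_bracket_normal[of "\<lambda>x. x"]) (use assms in \<open>auto simp: tangent_space_sphere\<close>)
  then show "lie_bracket N X Y p \<in> tangent_space N p"
    using p by (simp add: N_def tangent_space_sphere)
qed (use p in \<open>simp add: N_def subspace_tangent_sphere\<close>)

lemma levi_civita_torsion_free_torus:
  fixes X Y :: "'a::euclidean_space \<times> 'b::euclidean_space \<Rightarrow> 'a \<times> 'b"
  defines "N \<equiv> sphere (0::'a) 1 \<times> sphere (0::'b) 1"
  assumes "\<And>q. q \<in> N \<Longrightarrow> X q \<in> tangent_space N q" "\<And>q. q \<in> N \<Longrightarrow> Y q \<in> tangent_space N q"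
    and "X differentiable (at p within N)" "Y differentiable (at p within N)" and p: "p \<in> N"
  shows "levi_civita N Y p (X p) - levi_civita N X p (Y p) = lie_bracket N X Y p"
proof (rule levi_civita_torsion_free)
  have "lie_bracket N X Y p \<bullet> (fst p, 0) = 0"
    by (rule lie_bracket_normal[of "\<lambda>x. (fst x, 0)"])
      (use assms in \<open>auto simp: tangent_space_sphere tangent_space_Times inner_prod_def
        intro!: bounded_linear_Pair bounded_linear_fst bounded_linear_zero\<close>)
  moreover have "lie_bracket N X Y p \<bullet> (0, snd p) = 0"
    by (rule lie_bracket_normal[of "\<lambda>x. (0, snd x)"])
      (use assms in \<open>auto simp: tangent_space_sphere tangent_space_Times inner_prod_def
        intro!: bounded_linear_Pair bounded_linear_snd bounded_linear_zero\<close>)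
  ultimately show "lie_bracket N X Y p \<in> tangent_space N p"
    using p by (cases p, cases "lie_bracket N X Y p")
      (auto simp: N_def tangent_space_sphere tangent_space_Times inner_prod_def)
qed (use p in \<open>simp add: N_def subspace_tangent_torus\<close>)

lemma torus_induced_metric:
  defines "D \<equiv> \<lambda>(u::real) (v::real) (a::real, b::real). (a *\<^sub>R (\<i> * cis u), b *\<^sub>R (\<i> * cis v))"
  shows "((\<lambda>(u, v). (cis u, cis v)) has_derivative D u v) (at (u, v))"
    and "D u v x \<bullet> D u v y = x \<bullet> y"
proof -
  have "((\<lambda>z. (cis (fst z), cis (snd z))) has_derivative
      (\<lambda>h. (fst h *\<^sub>R (\<i> * cis (fst (u, v))), snd h *\<^sub>R (\<i> * cis (snd (u, v)))))) (at (u, v))"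
    by (intro has_derivative_Pair has_derivative_cis has_derivative_fst has_derivative_snd
        has_derivative_ident)
  then show "((\<lambda>(u, v). (cis u, cis v)) has_derivative D u v) (at (u, v))"
    by (simp add: D_def case_prod_unfold)
  have "i_cis t \<bullet> i_cis t = 1" if "i_cis = (\<lambda>t. \<i> * cis t)" for t and i_cis :: "real \<Rightarrow> complex"
    by (simp add: that dot_square_norm norm_mult)
  then show "D u v x \<bullet> D u v y = x \<bullet> y"
    by (cases x, cases y) (simp add: D_def inner_prod_def)
qed

end

theory Submission
  imports Defs
begin

text \<open>
  Identify \<open>\<real>\<^sup>4\<close> with \<open>\<complex>\<^sup>2\<close>.  Every field along \<open>\<phi>\<close> that occurs is a \<^emph>\<open>wave\<close>
  \[ W(c, d) = \frac{1}{\sqrt 2} (c e^{i (k_1 u + k_2 v)}, d e^{i (l_1 u + l_2 v)}) \]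
  with constant complex coefficients: \<open>\<phi> = W(1, 1)\<close>, and \<open>\<partial>\<^sub>u\<close> multiplies the coefficients by
  \<open>\<i>k\<^sub>1\<close> and \<open>\<i>l\<^sub>1\<close>, \<open>\<partial>\<^sub>v\<close> by \<open>\<i>k\<^sub>2\<close> and \<open>\<i>l\<^sub>2\<close> (\<open>has_partials_wave\<close>).  The projection to the tangent
  space of the sphere at \<open>\<phi>\<close> subtracts the mean of the real parts from both coefficients
  (\<open>tangent_proj_wave\<close>).  So both tension fields are found by arithmetic on \<open>c\<close> and \<open>d\<close>.

  Put \<open>K = k\<^sub>1\<^sup>2 + k\<^sub>2\<^sup>2\<close> and \<open>L = l\<^sub>1\<^sup>2 + l\<^sub>2\<^sup>2\<close>.  Because the torus is flat, the trace of a covariant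
  Hessian is the projection of \<open>\<partial>\<^sub>u\<^sup>2 + \<partial>\<^sub>v\<^sup>2\<close> (\<open>trace_hessian_torus\<close>).  Hence the tension field is the
  projection of \<open>W(-K, -L)\<close>, which is \<open>W(g, -g)\<close> with \<open>g = (L - K) / 2\<close>; it vanishes exactly when
  \<open>K = L\<close>.  Its first derivatives are imaginary waves and so already tangent, and the projection
  of its second derivatives gives the rough Laplacian \<open>(K + L) / 2 \<cdot> W(g, -g)\<close>.  On the other
  hand, \<open>W(g, -g)\<close> is orthogonal to the image of \<open>d\<phi>\<close>, so constant curvature 1 of the sphere
  (\<open>curvature_sphere\<close>) turns the curvature term into \<open>-|d\<phi>|\<^sup>2 W(g, -g)\<close>, where
  \<open>|d\<phi>|\<^sup>2 = (K + L) / 2\<close>.  The two terms of the bitension field cancel for all \<open>K\<close> and \<open>L\<close>: the map is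
  always biharmonic, and it is proper exactly when \<open>K \<noteq> L\<close>.
\<close>

section \<open>Tangent vectors and derivatives on the torus in angular coordinates\<close>

abbreviation torus :: "(complex \<times> complex) set" where
  "torus \<equiv> sphere 0 1 \<times> sphere 0 1"

definition tpoint :: "real \<Rightarrow> real \<Rightarrow> complex \<times> complex" where
  "tpoint s t = (cis s, cis t)"

text \<open>
  The tangent vector with components \<open>a\<close> and \<open>b\<close> in the orthonormal frame of the two angles.
\<close>

definition tvec :: "real \<Rightarrow> real \<Rightarrow> real \<Rightarrow> real \<Rightarrow> complex \<times> complex" where
  "tvec s t a b = (a *\<^sub>R (\<i> * cis s), b *\<^sub>R (\<i> * cis t))"

text \<open>
  The partial derivatives at one point of a function of two angles, bundled as total
  differentiability so that the chain rule applies.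
\<close>

definition has_partials ::
  "(real \<Rightarrow> real \<Rightarrow> 'b::real_normed_vector) \<Rightarrow> 'b \<Rightarrow> 'b \<Rightarrow> real \<Rightarrow> real \<Rightarrow> bool" where
  "has_partials F A B s t \<longleftrightarrow>
    ((\<lambda>z. F (fst z) (snd z)) has_derivative (\<lambda>h. fst h *\<^sub>R A + snd h *\<^sub>R B)) (at (s, t))"

lemma cis_Im_Ln: "norm z = 1 \<Longrightarrow> cis (Im (Ln z)) = z"
proof -
  assume z: "norm z = 1"
  then have "z \<noteq> 0" by auto
  then have "z = exp (Ln z)" by simp
  also have "\<dots> = cis (Im (Ln z))"
    using z \<open>z \<noteq> 0\<close> by (simp add: exp_eq_polar)
  finally show ?thesis by simp
qed

lemma inner_i_cis_i_cis: "(\<i> * cis s) \<bullet> (\<i> * cis t) = cos (t - s)"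
  by (simp add: inner_complex_def cos_diff)

lemma inner_cis_i_cis: "cis s \<bullet> (\<i> * cis s) = 0" "(\<i> * cis s) \<bullet> cis s = 0"
  by (simp_all add: inner_complex_def)

lemma tpoint_in_torus [simp]: "tpoint s t \<in> torus"
  by (simp add: tpoint_def)

lemma torus_cases:
  assumes "p \<in> torus" obtains s t where "p = tpoint s t"
proof -
  have "p = tpoint (Im (Ln (fst p))) (Im (Ln (snd p)))"
    using assms by (cases p) (simp add: tpoint_def cis_Im_Ln)
  then show ?thesis by (rule that)
qed

lemma orthogonal_cis_iff: "z \<bullet> cis s = 0 \<longleftrightarrow> (\<exists>a. z = a *\<^sub>R (\<i> * cis s))"
proof
  assume *: "z \<bullet> cis s = 0"
  have "z = (z \<bullet> (\<i> * cis s)) *\<^sub>R (\<i> * cis s) + (z \<bullet> cis s) *\<^sub>R cis s"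
  proof -
    have c: "cos s * cos s = 1 - sin s * sin s"
      using sin_cos_squared_add[of s] by (simp add: power2_eq_square)
    show ?thesis
      by (simp add: complex_eq_iff inner_complex_def c algebra_simps)
  qed
  with * show "\<exists>a. z = a *\<^sub>R (\<i> * cis s)" by auto
qed (auto simp: inner_cis_i_cis)

lemma tangent_space_torus: "tangent_space torus (tpoint s t) = {tvec s t a b | a b. True}"
  by (auto simp: tpoint_def tvec_def tangent_space_Times tangent_space_sphere orthogonal_cis_iff)

lemma tvec_tangent [simp]: "tvec s t a b \<in> tangent_space torus (tpoint s t)"
  by (auto simp: tangent_space_torus)

lemma tvec_0 [simp]: "tvec s t 0 0 = 0"
  by (simp add: tvec_def zero_prod_def)

lemma inner_tvec: "tvec s t a b \<bullet> tvec s t c d = a * c + b * d"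
  by (simp add: tvec_def inner_prod_def inner_i_cis_i_cis)

lemma tangent_proj_torus:
  "tangent_proj torus (tpoint s t) w = tvec s t (fst w \<bullet> (\<i> * cis s)) (snd w \<bullet> (\<i> * cis t))"
proof (rule tangent_proj_unique)
  show "subspace (tangent_space torus (tpoint s t))"
    by (rule subspace_tangent_torus) simp
next
  fix z assume "z \<in> tangent_space torus (tpoint s t)"
  then obtain a b where z: "z = tvec s t a b" by (auto simp: tangent_space_torus)
  show "tvec s t (fst w \<bullet> (\<i> * cis s)) (snd w \<bullet> (\<i> * cis t)) \<bullet> z = w \<bullet> z"
    unfolding z inner_tvec by (simp add: tvec_def inner_prod_def mult.commute)
qed simp

lemma has_derivative_angle:
  "((\<lambda>z. s + Im (Ln (z / cis s))) has_derivative (\<lambda>h. h \<bullet> (\<i> * cis s))) (at (cis s))"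
proof -
  have "((\<lambda>z. Ln (z / cis s)) has_field_derivative 1 / cis s) (at (cis s))"
    by (auto intro!: derivative_eq_intros)
  then have "((\<lambda>z. Ln (z / cis s)) has_derivative (\<lambda>h. 1 / cis s * h)) (at (cis s))"
    unfolding has_field_derivative_def .
  then have "((\<lambda>z. s + Im (Ln (z / cis s))) has_derivative (\<lambda>h. Im (1 / cis s * h))) (at (cis s))"
    by (auto intro!: derivative_eq_intros)
  moreover have "(\<lambda>h. Im (1 / cis s * h)) = (\<lambda>h. h \<bullet> (\<i> * cis s))"
  proof
    fix h
    have "1 / cis s = cis (- s)" by (metis cis_inverse inverse_eq_divide)
    then show "Im (1 / cis s * h) = h \<bullet> (\<i> * cis s)"
      by (simp add: inner_complex_def algebra_simps)
  qed
  ultimately show ?thesis by simp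
qed

text \<open>
  The angular coordinates have a smooth local inverse, namely
  \<open>(z, w) \<mapsto> (s + Im (Ln (z / cis s)), t + Im (Ln (w / cis t)))\<close>; rotating by \<open>cis s\<close> and \<open>cis t\<close>
  keeps the arguments of \<open>Ln\<close> near 1, away from its cut.  Composing \<open>F\<close> with it extends \<open>f\<close> to a
  neighbourhood of the point, so derivatives along the torus are partial derivatives in the angles.
\<close>

lemma differential_torus:
  assumes f: "\<And>x y. f (tpoint x y) = F x y" and F: "has_partials F A B s t"
  shows "differential torus f (tpoint s t) (tvec s t a b) = a *\<^sub>R A + b *\<^sub>R B"
proof -
  define \<theta> where "\<theta> = (\<lambda>z. (s + Im (Ln (fst z / cis s)), t + Im (Ln (snd z / cis t))))"
  have "(\<theta> has_derivative (\<lambda>h. (fst h \<bullet> (\<i> * cis s), snd h \<bullet> (\<i> * cis t)))) (at (tpoint s t))"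
    unfolding \<theta>_def tpoint_def
    using has_derivative_compose[where f = fst and x = "(cis s, cis t)",
        OF bounded_linear_imp_has_derivative[OF bounded_linear_fst],
        unfolded fst_conv, OF has_derivative_angle]
      has_derivative_compose[where f = snd and x = "(cis s, cis t)",
        OF bounded_linear_imp_has_derivative[OF bounded_linear_snd],
        unfolded snd_conv, OF has_derivative_angle]
    by (intro has_derivative_Pair)
  then have \<theta>: "(\<theta> has_derivative (\<lambda>h. (fst h \<bullet> (\<i> * cis s), snd h \<bullet> (\<i> * cis t))))
      (at (tpoint s t) within torus)"
    by (rule has_derivative_at_withinI)
  have "\<theta> (tpoint s t) = (s, t)"
    by (simp add: \<theta>_def tpoint_def)
  with F have "((\<lambda>z. F (fst z) (snd z)) has_derivative (\<lambda>h. fst h *\<^sub>R A + snd h *\<^sub>R B)) (at (\<theta> (tpoint s t)))"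
    by (simp add: has_partials_def)
  from has_derivative_compose[OF \<theta> this]
  have 1: "((\<lambda>z. F (fst (\<theta> z)) (snd (\<theta> z))) has_derivative
      (\<lambda>h. (fst h \<bullet> (\<i> * cis s)) *\<^sub>R A + (snd h \<bullet> (\<i> * cis t)) *\<^sub>R B)) (at (tpoint s t) within torus)"
    by simp
  have "f z = F (fst (\<theta> z)) (snd (\<theta> z))" if "z \<in> torus" for z
  proof -
    have "z = tpoint (fst (\<theta> z)) (snd (\<theta> z))"
      using that by (cases z) (simp add: \<theta>_def tpoint_def cis_Im_Ln norm_divide flip: cis_mult)
    then show ?thesis using f by metis
  qed
  from has_derivative_transform[OF tpoint_in_torus this 1]
  have 2: "(f has_derivative
      (\<lambda>h. (fst h \<bullet> (\<i> * cis s)) *\<^sub>R A + (snd h \<bullet> (\<i> * cis t)) *\<^sub>R B)) (at (tpoint s t) within torus)" .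
  show "differential torus f (tpoint s t) (tvec s t a b) = a *\<^sub>R A + b *\<^sub>R B"
    using differential_eq[OF 2 tvec_tangent[of s t a b]]
    by (simp add: tvec_def inner_i_cis_i_cis)
qed

section \<open>Traces over the torus\<close>

lemma tangent_proj_linear:
  assumes S: "subspace (tangent_space N p)"
  shows "linear (tangent_proj N p)"
proof (rule linearI)
  fix x y and r :: real
  show "tangent_proj N p (x + y) = tangent_proj N p x + tangent_proj N p y"
    using S by (intro tangent_proj_unique)
      (auto simp: tangent_proj_in tangent_proj_inner subspace_add inner_add_left)
  show "tangent_proj N p (r *\<^sub>R x) = r *\<^sub>R tangent_proj N p x"
    using S by (intro tangent_proj_unique)
      (auto simp: tangent_proj_in tangent_proj_inner subspace_scale)
qed

lemma orthonormal_Parseval: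
  assumes E: "orthonormal_basis V E" and x: "x \<in> V"
  shows "(\<Sum>e\<in>E. (e \<bullet> x) * (e \<bullet> y)) = x \<bullet> y"
proof -
  have "finite E" using E
    by (auto simp: orthonormal_basis_def intro: pairwise_orthogonal_imp_finite)
  then have "(\<Sum>e\<in>E. (x \<bullet> e) *\<^sub>R e) = x"
    using E x by (intro orthonormal_basis_expand) (auto simp: orthonormal_basis_def)
  then have "x \<bullet> y = (\<Sum>e\<in>E. (x \<bullet> e) *\<^sub>R e) \<bullet> y" by simp
  also have "\<dots> = (\<Sum>e\<in>E. (e \<bullet> x) * (e \<bullet> y))"
    by (simp only: inner_sum_left inner_scaleR_left inner_commute[of x])
  finally show ?thesis by simp
qed

text \<open>
  The trace is defined by an arbitrary orthonormal basis.  Parseval's identity evaluates the sums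
  of products of coordinates over any such basis, which makes the choice irrelevant and
  kills the mixed term.
\<close>

lemma metric_trace_torus:
  fixes s t
  defines "v \<equiv> tvec s t"
  assumes Q: "\<And>a b. Q (v a b) (v a b) = (a * a) *\<^sub>R H1 + (a * b) *\<^sub>R H2 + (b * b) *\<^sub>R H3"
  shows "metric_trace torus (tpoint s t) Q = H1 + H3"
proof -
  let ?V = "tangent_space torus (tpoint s t)"
  have "subspace ?V" by (rule subspace_tangent_torus) simp
  then have "\<exists>E. orthonormal_basis ?V E"
    unfolding orthonormal_basis_def by (metis orthonormal_basis_subspace)
  then have E: "orthonormal_basis ?V (SOME E. orthonormal_basis ?V E)" (is "orthonormal_basis ?V ?E")
    by (rule someI_ex)
  have EV: "?E \<subseteq> ?V" using E span_superset[of ?E] by (simp only: orthonormal_basis_def)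
  have eq: "Q e e = ((e \<bullet> v 1 0) * (e \<bullet> v 1 0)) *\<^sub>R H1 + ((e \<bullet> v 1 0) * (e \<bullet> v 0 1)) *\<^sub>R H2
      + ((e \<bullet> v 0 1) * (e \<bullet> v 0 1)) *\<^sub>R H3" if e: "e \<in> ?E" for e
  proof -
    from EV e obtain a b where e: "e = v a b" by (auto simp: tangent_space_torus v_def)
    show ?thesis unfolding e Q by (simp add: v_def inner_tvec)
  qed
  have P: "(\<Sum>e\<in>?E. (e \<bullet> x) * (e \<bullet> y)) = x \<bullet> y" if "x \<in> ?V" for x y
    using that by (rule orthonormal_Parseval[OF E])
  have "metric_trace torus (tpoint s t) Q = (v 1 0 \<bullet> v 1 0) *\<^sub>R H1 + (v 1 0 \<bullet> v 0 1) *\<^sub>R H2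
      + (v 0 1 \<bullet> v 0 1) *\<^sub>R H3"
    unfolding metric_trace_def
    by (simp add: eq sum.distrib P v_def flip: scaleR_sum_left cong: sum.cong)
  then show ?thesis by (simp add: v_def inner_tvec)
qed

lemma has_partials_cos_scaleR:
  assumes "has_partials A A1 A2 s t" "has_partials B B1 B2 s t"
  shows "has_partials (\<lambda>x y. (\<alpha> * cos (x - s)) *\<^sub>R A x y + (\<beta> * cos (y - t)) *\<^sub>R B x y)
    (\<alpha> *\<^sub>R A1 + \<beta> *\<^sub>R B1) (\<alpha> *\<^sub>R A2 + \<beta> *\<^sub>R B2) s t"
  using assms unfolding has_partials_def
  by (auto intro!: derivative_eq_intros simp: algebra_simps)

lemma extend_tangent_torus:
  "extend_tangent torus (tvec s t \<alpha> \<beta>) (tpoint x y) = tvec x y (\<alpha> * cos (x - s)) (\<beta> * cos (y - t))"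
  by (simp add: extend_tangent_def tangent_proj_torus)
     (simp add: tvec_def inner_i_cis_i_cis)

text \<open>
  The projection of a constant vector is parallel at the base point: there the factors
  \<open>cos (x - s)\<close> and \<open>cos (y - t)\<close> are stationary, and the derivative of the coordinate field
  \<open>\<i> * cis x\<close> is radial.
\<close>

lemma levi_civita_extend_tangent_torus:
  "levi_civita torus (extend_tangent torus (tvec s t \<alpha> \<beta>)) (tpoint s t) (tvec s t a b) = 0"
proof -
  have 1: "extend_tangent torus (tvec s t \<alpha> \<beta>) (tpoint x y)
      = (\<alpha> * cos (x - s)) *\<^sub>R (\<i> * cis x, 0) + (\<beta> * cos (y - t)) *\<^sub>R (0, \<i> * cis y)" for x y
    unfolding extend_tangent_torus by (simp add: tvec_def)
  have "has_partials (\<lambda>x y. (\<i> * cis x, 0) :: complex \<times> complex) (- cis s, 0) 0 s t"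
    unfolding has_partials_def
    by (rule derivative_eq_intros | force simp: zero_prod_def)+
  moreover have "has_partials (\<lambda>x y. (0, \<i> * cis y) :: complex \<times> complex) 0 (0, - cis t) s t"
    unfolding has_partials_def
    by (rule derivative_eq_intros | force simp: zero_prod_def)+
  ultimately have "has_partials (\<lambda>x y. (\<alpha> * cos (x - s)) *\<^sub>R (\<i> * cis x, 0) + (\<beta> * cos (y - t)) *\<^sub>R (0, \<i> * cis y))
     (\<alpha> *\<^sub>R (- cis s, 0) + \<beta> *\<^sub>R 0) (\<alpha> *\<^sub>R 0 + \<beta> *\<^sub>R (0, - cis t)) s t"
    by (rule has_partials_cos_scaleR)
  from differential_torus[OF 1 this] show ?thesis
    by (simp add: levi_civita_def cov_deriv_def tangent_proj_torus inner_cis_i_cis)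
qed

text \<open>
  The common form of \<open>trace \<nabla>d\<phi>\<close> and \<open>trace \<nabla>\<^sup>2\<sigma>\<close>: take \<open>G = d\<phi>\<close> or \<open>G = \<nabla>\<sigma>\<close>, a one-form with values in
  the bundle, with components \<open>A\<close> and \<open>B\<close> in the angular frame.  The correction term
  \<open>G (\<nabla>\<^sub>v W)\<close> vanishes because \<open>W\<close> is parallel at the point.  Flatness enters through the parallel
  angular frame: the components of \<open>W\<close> in it are stationary, so only \<open>A\<close> and \<open>B\<close> get differentiated, and
  the trace keeps their diagonal derivatives.
\<close>

lemma trace_hessian_torus:
  assumes N: "subspace (tangent_space N (\<phi> (tpoint s t)))"
    and G: "\<And>x y a b. G (tpoint x y) (tvec x y a b) = a *\<^sub>R A x y + b *\<^sub>R B x y"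
    and A: "has_partials A A1 A2 s t" and B: "has_partials B B1 B2 s t"
  shows "metric_trace torus (tpoint s t) (\<lambda>v w.
      cov_deriv torus N \<phi> (\<lambda>q. G q (extend_tangent torus w q)) (tpoint s t) v
      - G (tpoint s t) (levi_civita torus (extend_tangent torus w) (tpoint s t) v))
    = tangent_proj N (\<phi> (tpoint s t)) (A1 + B2)"
proof -
  let ?P = "tangent_proj N (\<phi> (tpoint s t))"
  note lin = tangent_proj_linear[OF N]
  have "G (tpoint s t) 0 = 0" using G[of s t 0 0] by simp
  then have "metric_trace torus (tpoint s t) (\<lambda>v w.
      cov_deriv torus N \<phi> (\<lambda>q. G q (extend_tangent torus w q)) (tpoint s t) v
      - G (tpoint s t) (levi_civita torus (extend_tangent torus w) (tpoint s t) v))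
     = ?P A1 + ?P B2"
    using lin
    by (intro metric_trace_torus[where ?H2.0 = "?P B1 + ?P A2"])
      (simp add: levi_civita_extend_tangent_torus cov_deriv_def
        differential_torus[OF _ has_partials_cos_scaleR[OF A B]] G extend_tangent_torus
        linear_add linear_cmul algebra_simps)
  then show ?thesis using lin by (simp add: linear_add)
qed

section \<open>The curvature of the unit sphere\<close>

lemma tangent_proj_sphere:
  assumes "norm p = 1"
  shows "tangent_proj (sphere 0 1) p v = v - (v \<bullet> p) *\<^sub>R p"
proof (rule tangent_proj_unique)
  have "p \<bullet> p = 1" using assms by (simp add: dot_square_norm)
  then show "v - (v \<bullet> p) *\<^sub>R p \<in> tangent_space (sphere 0 1) p"
    using assms by (simp add: tangent_space_sphere inner_diff_left)
  show "(v - (v \<bullet> p) *\<^sub>R p) \<bullet> z = v \<bullet> z" if "z \<in> tangent_space (sphere 0 1) p" for z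
    using that assms by (simp add: tangent_space_sphere inner_diff_left inner_commute[of p])
qed (use assms in \<open>simp add: subspace_tangent_sphere\<close>)

text \<open>
  A formula valid on the sphere alone may be differentiated in the ambient space along tangent
  vectors.
\<close>

lemma levi_civita_sphere:
  assumes "\<And>q. norm q = 1 \<Longrightarrow> Y q = F q" "(F has_derivative D) (at p)" "norm p = 1" "v \<bullet> p = 0"
  shows "levi_civita (sphere 0 1) Y p v = D v - (D v \<bullet> p) *\<^sub>R p"
    and "differential (sphere 0 1) Y p v = D v"
proof -
  have "(Y has_derivative D) (at p within sphere 0 1)"
    using assms by (intro has_derivative_transform[OF _ _ has_derivative_at_withinI[OF assms(2)]]) auto
  then show *: "differential (sphere 0 1) Y p v = D v"
    using assms by (intro differential_eq) (auto simp: tangent_space_sphere)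
  then show "levi_civita (sphere 0 1) Y p v = D v - (D v \<bullet> p) *\<^sub>R p"
    using assms by (simp add: levi_civita_def cov_deriv_def tangent_proj_sphere)
qed

text \<open>
  The projected extension \<open>Z q = z - (z \<bullet> q) q\<close> satisfies \<open>\<nabla>\<^sub>v Z = - (z \<bullet> q) v\<close>, which vanishes at
  \<open>p\<close> because \<open>z\<close> is tangent there.  A second derivative at \<open>p\<close> can therefore only hit the factor
  \<open>z \<bullet> q\<close>; this gives both terms.
\<close>

lemma curvature_sphere:
  fixes p x y z :: "'a::euclidean_space"
  assumes p: "norm p = 1" and xyz: "x \<bullet> p = 0" "y \<bullet> p = 0" "z \<bullet> p = 0"
  shows "curvature (sphere 0 1) p x y z = (z \<bullet> y) *\<^sub>R x - (z \<bullet> x) *\<^sub>R y"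
proof -
  let ?N = "sphere (0::'a) 1"
  let ?e = "extend_tangent ?N"
  have e: "?e w q = w - (w \<bullet> q) *\<^sub>R q" if "norm q = 1" for w q
    using that by (simp add: extend_tangent_def tangent_proj_sphere)
  have pp: "p \<bullet> p = 1" using p by (simp add: dot_square_norm)
  have de: "((\<lambda>q. w - (w \<bullet> q) *\<^sub>R q) has_derivative (\<lambda>h. - ((w \<bullet> q) *\<^sub>R h + (w \<bullet> h) *\<^sub>R q))) (at q)"
    for w q :: 'a
    by (auto intro!: derivative_eq_intros)
  have 1: "levi_civita ?N (?e w) q v = - (w \<bullet> q) *\<^sub>R v" if "norm q = 1" "v \<bullet> q = 0" for w q v
  proof -
    have "q \<bullet> q = 1" using that by (simp add: dot_square_norm)
    then show ?thesis
      using levi_civita_sphere(1)[OF e de that] that by (simp add: algebra_simps)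
  qed
  have 2: "levi_civita ?N (?e w) q (?e u q) = - ((w \<bullet> q) *\<^sub>R (u - (u \<bullet> q) *\<^sub>R q))" if "norm q = 1" for w q u
  proof -
    have "q \<bullet> q = 1" using that by (simp add: dot_square_norm)
    then show ?thesis
      using that by (subst 1) (simp_all add: e inner_diff_left)
  qed
  have 3: "levi_civita ?N (\<lambda>q. levi_civita ?N (?e z) q (?e w q)) p v = - ((z \<bullet> v) *\<^sub>R w)"
    if "w \<bullet> p = 0" "v \<bullet> p = 0" for w v
  proof -
    have "((\<lambda>q. - ((z \<bullet> q) *\<^sub>R (w - (w \<bullet> q) *\<^sub>R q))) has_derivative
        (\<lambda>h. - ((z \<bullet> p) *\<^sub>R - ((w \<bullet> p) *\<^sub>R h + (w \<bullet> h) *\<^sub>R p) + (z \<bullet> h) *\<^sub>R (w - (w \<bullet> p) *\<^sub>R p)))) (at p)"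
      by (intro has_derivative_minus has_derivative_scaleR de has_derivative_inner_right has_derivative_ident)
    from levi_civita_sphere(1)[OF 2 this p that(2)] show ?thesis
      using that xyz by simp
  qed
  have 4: "lie_bracket ?N (?e x) (?e y) p = 0"
    using xyz levi_civita_sphere(2)[OF e de p] by (simp add: lie_bracket_def e p inner_commute)
  have ep: "?e w p = w" if "w \<bullet> p = 0" for w
    using that p by (simp add: e)
  show ?thesis
    using xyz by (simp add: curvature_def ep 3 4 1 p)
qed

section \<open>Smoothness of monomials\<close>

lemma Ck_on_cong:
  assumes "open U" "\<And>x. x \<in> U \<Longrightarrow> f x = g x" "Ck_on k U f"
  shows "Ck_on k U g"
  using assms(2,3)
proof (induction k arbitrary: f g)
  case 0
  then show ?case using continuous_on_cong[of U U f g] by auto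
next
  case (Suc k)
  have d: "f differentiable (at x)" if "x \<in> U" for x
    using Suc that by auto
  have eq: "frechet_derivative f (at x) = frechet_derivative g (at x)" if "x \<in> U" for x
    using frechet_derivative_transform_within_open[OF d assms(1)] Suc that by blast
  have "g differentiable (at x)" if "x \<in> U" for x
    using d[OF that] has_derivative_transform_within_open[of f _ x UNIV U g] assms(1) that Suc(2)
    unfolding differentiable_def by blast
  moreover have "Ck_on k U (\<lambda>x. frechet_derivative g (at x) v)" for v
    by (rule Suc(1)[of "\<lambda>x. frechet_derivative f (at x) v"]) (use Suc eq in auto)
  ultimately show ?case by simp
qed

lemma Ck_on_add:
  assumes "open U" "Ck_on k U f" "Ck_on k U g"
  shows "Ck_on k U (\<lambda>x. f x + g x)"
  using assms(2,3)
proof (induction k arbitrary: f g)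
  case 0
  then show ?case by (simp add: continuous_on_add)
next
  case (Suc k)
  have eq: "frechet_derivative (\<lambda>x. f x + g x) (at x) v
      = frechet_derivative f (at x) v + frechet_derivative g (at x) v" if "x \<in> U" for x v
    using Suc that
    by (intro fun_cong[OF frechet_derivative_at[symmetric]] has_derivative_add)
      (simp_all add: frechet_derivative_works)
  have "Ck_on k U (\<lambda>x. frechet_derivative (\<lambda>x. f x + g x) (at x) v)" for v
    by (rule Ck_on_cong[OF assms(1) _ Suc(1)[of "\<lambda>x. frechet_derivative f (at x) v"
            "\<lambda>x. frechet_derivative g (at x) v"]]) (use eq Suc in auto)
  then show ?case using Suc by (simp add: differentiable_add)
qed

text \<open>
  Quantifying over the linear map \<open>L\<close> makes the induction close: a directional derivative of a
  Laurent monomial is a sum of two such monomials, and their constant coefficients are absorbed into \<open>L\<close>.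
\<close>

lemma Ck_on_monomial:
  fixes L :: "complex \<Rightarrow> 'b::euclidean_space"
  assumes "bounded_linear L"
  shows "Ck_on k ((- {0}) \<times> (- {0})) (\<lambda>z. L (fst z powi m * snd z powi n))"
  using assms
proof (induction k arbitrary: L m n)
  case 0
  have "continuous_on ((- {0}) \<times> (- {0})) (\<lambda>z::complex \<times> complex. fst z powi m * snd z powi n)"
    by (intro continuous_intros) auto
  from bounded_linear.continuous_on[OF 0 this] show ?case
    by simp
next
  case (Suc k)
  let ?U = "(- {0}) \<times> (- {0}) :: (complex \<times> complex) set"
  let ?f = "\<lambda>z. L (fst z powi m * snd z powi n)"
  have U: "open ?U" by (intro open_Times) auto
  define D where "D = (\<lambda>(z::complex \<times> complex) v.
    L ((of_int m * fst v) * (fst z powi (m - 1) * snd z powi n)) +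
    L ((of_int n * snd v) * (fst z powi m * snd z powi (n - 1))))"
  have d: "(?f has_derivative D z) (at z)" if z: "z \<in> ?U" for z
  proof -
    have "((\<lambda>z. fst z powi m * snd z powi n) has_derivative
       (\<lambda>v. fst z powi m * (snd v * (of_int n * snd z powi (n - 1)))
          + fst v * (of_int m * fst z powi (m - 1)) * snd z powi n)) (at z)"
      using z by (intro has_derivative_mult has_derivative_power_int has_derivative_fst
          has_derivative_snd has_derivative_ident) auto
    from bounded_linear.has_derivative[OF Suc.prems this] show ?thesis
      unfolding D_def
      by (simp add: linear_add[OF bounded_linear.linear[OF Suc.prems], symmetric] algebra_simps)
  qed
  have "Ck_on k ?U (\<lambda>z. D z v)" for v
    unfolding D_def
    by (intro Ck_on_add[OF U] Suc.IH bounded_linear_compose[OF Suc.prems bounded_linear_mult_right])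
  then have "Ck_on k ?U (\<lambda>z. frechet_derivative ?f (at z) v)" for v
    by (rule Ck_on_cong[OF U, rotated]) (use frechet_derivative_at[OF d] in auto)
  moreover have "?f differentiable (at z)" if "z \<in> ?U" for z
    using d[OF that] by (rule differentiableI)
  ultimately show ?case by simp
qed

section \<open>Waves on the Clifford torus\<close>

text \<open>
  The isomorphism of \<open>\<complex>\<^sup>2\<close> with \<open>\<real>\<^sup>4\<close>, scaled so that it maps the torus of pairs of unit complex numbers
  onto the Clifford torus in the unit sphere.
\<close>

definition clifford :: "complex \<Rightarrow> complex \<Rightarrow> real ^ 4" where
  "clifford z w = (1 / sqrt 2) *\<^sub>R vector [Re z, Im z, Re w, Im w]"

lemma vector_4_eqI: "(\<And>i. i \<in> {1, 2, 3, 4} \<Longrightarrow> x $ i = y $ i) \<Longrightarrow> x = (y :: real ^ 4)"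
  by (simp add: vec_eq_iff forall_4)

lemma inner_clifford: "clifford z w \<bullet> clifford z' w' = (z \<bullet> z' + w \<bullet> w') / 2"
  by (simp add: clifford_def inner_vec_def sum_4 inner_complex_def field_simps)

lemma clifford_add: "clifford (z + z') (w + w') = clifford z w + clifford z' w'"
  and clifford_scaleR: "clifford (r *\<^sub>R z) (r *\<^sub>R w) = r *\<^sub>R clifford z w"
  by (auto intro!: vector_4_eqI simp: clifford_def algebra_simps add_divide_distrib)

lemma clifford_split: "clifford z w = clifford z 0 + clifford 0 w"
  using clifford_add[of z 0 0 w] by simp

lemma bounded_linear_clifford: "bounded_linear (\<lambda>z. clifford (fst z) (snd z))"
  unfolding linear_conv_bounded_linear[symmetric]
  by (intro linearI) (simp_all add: clifford_add clifford_scaleR)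

lemma bounded_linear_clifford_fst: "bounded_linear (\<lambda>z. clifford z 0)"
  and bounded_linear_clifford_snd: "bounded_linear (\<lambda>w. clifford 0 w)"
  using bounded_linear_compose[OF bounded_linear_clifford bounded_linear_Pair[OF bounded_linear_ident bounded_linear_zero]]
    bounded_linear_compose[OF bounded_linear_clifford bounded_linear_Pair[OF bounded_linear_zero bounded_linear_ident]]
  by simp_all

context
  fixes k1 k2 l1 l2 :: real
begin

definition wave :: "complex \<Rightarrow> complex \<Rightarrow> real \<Rightarrow> real \<Rightarrow> real ^ 4" where
  "wave c d s t = clifford (c * cis (k1 * s + k2 * t)) (d * cis (l1 * s + l2 * t))"

lemma wave_add: "wave c d s t + wave c' d' s t = wave (c + c') (d + d') s t"
  by (simp add: wave_def algebra_simps flip: clifford_add)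

lemma wave_scaleR: "r *\<^sub>R wave c d s t = wave (of_real r * c) (of_real r * d) s t"
  unfolding wave_def clifford_scaleR[symmetric] by (simp add: scaleR_conv_of_real mult.assoc)

lemma inner_wave: "wave c d s t \<bullet> wave c' d' s t = (c \<bullet> c' + d \<bullet> d') / 2"
proof -
  have "(z * cis \<theta>) \<bullet> (w * cis \<theta>) = z \<bullet> w" for z w \<theta>
  proof -
    have "(z * cis \<theta>) \<bullet> (w * cis \<theta>) = Re ((z * cis \<theta>) * cnj (w * cis \<theta>))"
      by (cases "z * cis \<theta>"; cases "w * cis \<theta>")
        (simp add: inner_complex_def)
    also have "(z * cis \<theta>) * cnj (w * cis \<theta>) = z * cnj w * (cis \<theta> * cis (- \<theta>))"
      by (simp add: cis_cnj mult_ac)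
    also have "Re \<dots> = z \<bullet> w" by (simp add: cis_mult inner_complex_def)
    finally show ?thesis .
  qed
  then show ?thesis by (simp add: wave_def inner_clifford)
qed

lemma has_partials_wave:
  "has_partials (wave c d) (wave (\<i> * k1 * c) (\<i> * l1 * d) s t) (wave (\<i> * k2 * c) (\<i> * l2 * d) s t) s t"
proof -
  have "((\<lambda>z. (c * cis (k1 * fst z + k2 * snd z), d * cis (l1 * fst z + l2 * snd z))) has_derivative
     (\<lambda>h. (c * ((k1 * fst h + k2 * snd h) *\<^sub>R (\<i> * cis (k1 * fst (s, t) + k2 * snd (s, t)))),
           d * ((l1 * fst h + l2 * snd h) *\<^sub>R (\<i> * cis (l1 * fst (s, t) + l2 * snd (s, t))))))) (at (s, t))"
    by (intro has_derivative_Pair has_derivative_mult_right has_derivative_cis has_derivative_add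
        has_derivative_fst has_derivative_snd has_derivative_ident)
  from bounded_linear.has_derivative[OF bounded_linear_clifford this]
  show ?thesis
    unfolding has_partials_def wave_scaleR wave_add
    by (simp add: wave_def scaleR_conv_of_real algebra_simps)
qed

lemma norm_wave: "norm c = 1 \<Longrightarrow> norm d = 1 \<Longrightarrow> norm (wave c d s t) = 1"
  by (simp add: norm_eq_sqrt_inner inner_wave)

text \<open>
  Subtracting the normal component \<open>(W(c, d) \<bullet> \<phi>) \<phi>\<close>, where \<open>\<phi> = W(1, 1)\<close>, shifts both coefficients by the
  same real number.
\<close>

lemma tangent_proj_wave:
  "tangent_proj (sphere 0 1) (wave 1 1 s t) (wave c d s t) =
    wave (c - of_real ((Re c + Re d) / 2)) (d - of_real ((Re c + Re d) / 2)) s t"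
proof -
  have "tangent_proj (sphere 0 1) (wave 1 1 s t) (wave c d s t)
      = wave c d s t + (- ((Re c + Re d) / 2)) *\<^sub>R wave 1 1 s t"
    by (subst tangent_proj_sphere) (simp_all add: norm_wave inner_wave inner_complex_def)
  then show ?thesis
    unfolding wave_scaleR wave_add by simp
qed

text \<open>
  The coefficient of the tension field with respect to the unit normal \<open>wave 1 (- 1)\<close> of the Clifford torus.
\<close>

abbreviation "gap \<equiv> ((l1\<^sup>2 + l2\<^sup>2) - (k1\<^sup>2 + k2\<^sup>2)) / 2"

context
  fixes \<phi> :: "complex \<times> complex \<Rightarrow> real ^ 4"
  assumes \<phi>: "\<And>s t. \<phi> (tpoint s t) = wave 1 1 s t"
begin

lemma subspace_tangent_wave: "subspace (tangent_space (sphere 0 1) (\<phi> (tpoint s t)))"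
  by (rule subspace_tangent_sphere) (simp add: \<phi> norm_wave)

lemma differential_wave:
  assumes "\<And>s t. \<sigma> (tpoint s t) = wave c d s t"
  shows "differential torus \<sigma> (tpoint s t) (tvec s t a b) =
    a *\<^sub>R wave (\<i> * k1 * c) (\<i> * l1 * d) s t + b *\<^sub>R wave (\<i> * k2 * c) (\<i> * l2 * d) s t"
  using assms has_partials_wave by (rule differential_torus)

lemma tension_wave: "tension torus (sphere 0 1) \<phi> (tpoint s t) = wave gap (- gap) s t"
proof -
  have "tension torus (sphere 0 1) \<phi> (tpoint s t) =
    tangent_proj (sphere 0 1) (\<phi> (tpoint s t))
      (wave (\<i> * k1 * (\<i> * k1 * 1)) (\<i> * l1 * (\<i> * l1 * 1)) s t +
       wave (\<i> * k2 * (\<i> * k2 * 1)) (\<i> * l2 * (\<i> * l2 * 1)) s t)"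
    unfolding tension_def nabla_differential_def[abs_def] Let_def
    by (rule trace_hessian_torus[where \<phi> = \<phi> and s = s and t = t and G = "differential torus \<phi>",
          OF subspace_tangent_wave differential_wave[OF \<phi>]
          has_partials_wave has_partials_wave])
  also have "\<dots> = wave gap (- gap) s t"
    unfolding \<phi> wave_add tangent_proj_wave
    by (rule arg_cong2[where f = "\<lambda>c d. wave c d s t"])
      (simp_all add: complex_eq_iff power2_eq_square field_simps)
  finally show ?thesis .
qed

text \<open>
  No projection is left on the right-hand side: the coefficients of the ambient derivatives are
  imaginary, so these derivatives are already tangent to the sphere.
\<close>

lemma cov_deriv_tension:
  "cov_deriv torus (sphere 0 1) \<phi> (tension torus (sphere 0 1) \<phi>) (tpoint s t) (tvec s t a b) =
    a *\<^sub>R wave (\<i> * k1 * gap) (\<i> * l1 * (- gap)) s t + b *\<^sub>R wave (\<i> * k2 * gap) (\<i> * l2 * (- gap)) s t"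
  unfolding cov_deriv_def differential_wave[OF tension_wave] wave_scaleR wave_add \<phi> tangent_proj_wave
  by simp

lemma rough_laplacian_tension:
  "rough_laplacian torus (sphere 0 1) \<phi> (tension torus (sphere 0 1) \<phi>) (tpoint s t) =
    ((k1\<^sup>2 + k2\<^sup>2 + l1\<^sup>2 + l2\<^sup>2) / 2) *\<^sub>R wave gap (- gap) s t"
proof -
  have "- rough_laplacian torus (sphere 0 1) \<phi> (tension torus (sphere 0 1) \<phi>) (tpoint s t) =
    tangent_proj (sphere 0 1) (\<phi> (tpoint s t))
      (wave (\<i> * k1 * (\<i> * k1 * gap)) (\<i> * l1 * (\<i> * l1 * (- gap))) s t +
       wave (\<i> * k2 * (\<i> * k2 * gap)) (\<i> * l2 * (\<i> * l2 * (- gap))) s t)"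
    unfolding rough_laplacian_def second_cov_deriv_def[abs_def] Let_def minus_minus
    by (rule trace_hessian_torus[where \<phi> = \<phi> and s = s and t = t
          and G = "cov_deriv torus (sphere 0 1) \<phi> (tension torus (sphere 0 1) \<phi>)",
          OF subspace_tangent_wave cov_deriv_tension
          has_partials_wave has_partials_wave])
  also have "\<dots> = (- ((k1\<^sup>2 + k2\<^sup>2 + l1\<^sup>2 + l2\<^sup>2) / 2)) *\<^sub>R wave gap (- gap) s t"
  proof -
    \<comment> \<open>The identity is linear in the value of \<open>gap\<close>, which is kept opaque for the simplifier.\<close>
    define g where "g = gap"
    show ?thesis
      unfolding \<phi> wave_add tangent_proj_wave wave_scaleR g_def[symmetric]
      by (rule arg_cong2[where f = "\<lambda>c d. wave c d s t"])
        (simp_all add: complex_eq_iff power2_eq_square algebra_simps add_divide_distrib diff_divide_distrib)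
  qed
  finally show ?thesis unfolding scaleR_minus_left neg_equal_iff_equal .
qed

text \<open>
  The image of \<open>d\<phi>\<close> consists of waves with imaginary coefficients, the tension field has real
  ones, so they are orthogonal and \<open>R(d\<phi> v, \<tau>) d\<phi> v = - |d\<phi> v|\<^sup>2 \<tau>\<close>.
\<close>

lemma trace_curvature_tension:
  "metric_trace torus (tpoint s t) (\<lambda>v w. curvature (sphere 0 1) (\<phi> (tpoint s t))
     (differential torus \<phi> (tpoint s t) v) (tension torus (sphere 0 1) \<phi> (tpoint s t))
     (differential torus \<phi> (tpoint s t) w)) =
   - ((k1\<^sup>2 + k2\<^sup>2 + l1\<^sup>2 + l2\<^sup>2) / 2) *\<^sub>R wave gap (- gap) s t"
proof -
  let ?T = "wave gap (- gap) s t"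
  have "curvature (sphere 0 1) (\<phi> (tpoint s t))
     (differential torus \<phi> (tpoint s t) (tvec s t a b)) (tension torus (sphere 0 1) \<phi> (tpoint s t))
     (differential torus \<phi> (tpoint s t) (tvec s t a b)) =
     (a * a) *\<^sub>R (- ((k1\<^sup>2 + l1\<^sup>2) / 2)) *\<^sub>R ?T + (a * b) *\<^sub>R (- (k1 * k2 + l1 * l2)) *\<^sub>R ?T
     + (b * b) *\<^sub>R (- ((k2\<^sup>2 + l2\<^sup>2) / 2)) *\<^sub>R ?T" (is "?R = _") for a b
  proof -
    let ?X = "wave (\<i> * (a * k1 + b * k2)) (\<i> * (a * l1 + b * l2)) s t"
    have X: "differential torus \<phi> (tpoint s t) (tvec s t a b) = ?X"
      unfolding differential_wave[OF \<phi>] wave_scaleR wave_add by (simp add: algebra_simps)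
    have "?R = (?X \<bullet> ?T) *\<^sub>R ?X - (?X \<bullet> ?X) *\<^sub>R ?T"
      unfolding X tension_wave \<phi>
      by (rule curvature_sphere) (simp_all add: norm_wave inner_wave inner_complex_def)
    also have "?X \<bullet> ?T = 0"
      by (simp add: inner_wave inner_complex_def)
    also have "?X \<bullet> ?X = (a * a) * ((k1\<^sup>2 + l1\<^sup>2) / 2) + (a * b) * (k1 * k2 + l1 * l2)
        + (b * b) * ((k2\<^sup>2 + l2\<^sup>2) / 2)"
      by (simp add: inner_wave inner_complex_def power2_eq_square field_simps)
    finally show ?thesis by (simp add: algebra_simps)
  qed
  then have "metric_trace torus (tpoint s t) (\<lambda>v w. curvature (sphere 0 1) (\<phi> (tpoint s t))
     (differential torus \<phi> (tpoint s t) v) (tension torus (sphere 0 1) \<phi> (tpoint s t))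
     (differential torus \<phi> (tpoint s t) w)) =
     (- ((k1\<^sup>2 + l1\<^sup>2) / 2)) *\<^sub>R ?T + (- ((k2\<^sup>2 + l2\<^sup>2) / 2)) *\<^sub>R ?T"
    by (rule metric_trace_torus)
  also have "\<dots> = - ((k1\<^sup>2 + k2\<^sup>2 + l1\<^sup>2 + l2\<^sup>2) / 2) *\<^sub>R ?T"
    unfolding scaleR_left_distrib[symmetric] by (simp add: add_divide_distrib)
  finally show ?thesis .
qed

lemma bitension_wave: "bitension torus (sphere 0 1) \<phi> (tpoint s t) = 0"
  by (simp add: bitension_def rough_laplacian_tension trace_curvature_tension)

lemma tension_wave_eq_0_iff: "tension torus (sphere 0 1) \<phi> (tpoint s t) = 0 \<longleftrightarrow> l1\<^sup>2 + l2\<^sup>2 = k1\<^sup>2 + k2\<^sup>2"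
proof -
  have "tension torus (sphere 0 1) \<phi> (tpoint s t) = gap *\<^sub>R wave 1 (- 1) s t"
    by (simp add: tension_wave wave_scaleR)
  moreover have "wave 1 (- 1) s t \<noteq> 0"
    using norm_wave[of 1 "- 1" s t] by auto
  ultimately show ?thesis by simp
qed

end

end

section \<open>Proper biharmonicity\<close>

text \<open>
  For integer frequencies the exponentials are Laurent monomials in the torus coordinates, which extend
  smoothly to all pairs of nonzero complex numbers; for other frequencies \<open>\<phi>\<close> would not even be
  well defined on the torus.
\<close>

lemma smooth_map_wave:
  fixes k1 k2 l1 l2 :: int
  assumes \<phi>: "\<And>s t. \<phi> (tpoint s t) = wave k1 k2 l1 l2 1 1 s t"
  shows "smooth_map torus (sphere 0 1) \<phi>"
  unfolding smooth_map_def
proof (intro conjI ballI)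
  show "\<phi> ` torus \<subseteq> sphere 0 1"
    by (auto simp: \<phi> norm_wave elim!: torus_cases simp del: mem_Times_iff)
next
  let ?U = "(- {0}) \<times> (- {0}) :: (complex \<times> complex) set"
  let ?F = "\<lambda>z. clifford (fst z powi k1 * snd z powi k2) 0 + clifford 0 (fst z powi l1 * snd z powi l2)"
  fix p assume p: "p \<in> torus"
  have U: "open ?U" by (intro open_Times) auto
  moreover have "\<forall>k. Ck_on k ?U ?F"
    by (intro allI Ck_on_add[OF U] Ck_on_monomial bounded_linear_clifford_fst bounded_linear_clifford_snd)
  moreover have "?F q = \<phi> q" if "q \<in> ?U \<inter> torus" for q
  proof -
    from that have "q \<in> torus" by blast
    then obtain s t where q: "q = tpoint s t" by (rule torus_cases)
    show ?thesis
      unfolding q \<phi> clifford_split[symmetric]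
      by (simp add: tpoint_def wave_def cis_power_int cis_mult)
  qed
  moreover have "p \<in> ?U" using p by (auto simp: mem_Times_iff)
  ultimately show "\<exists>U F. open U \<and> p \<in> U \<and> (\<forall>k. Ck_on k U F) \<and> (\<forall>q\<in>U \<inter> torus. F q = \<phi> q)"
    by blast
qed

theorem proposition2p8:
  fixes k1 k2 l1 l2 :: int and \<phi> :: "complex \<times> complex \<Rightarrow> real ^ 4"
  assumes "\<And>u v :: real. \<phi> (cis u, cis v) =
    (1 / sqrt 2) *\<^sub>R vector [cos (of_int k1 * u + of_int k2 * v), sin (of_int k1 * u + of_int k2 * v),
                            cos (of_int l1 * u + of_int l2 * v), sin (of_int l1 * u + of_int l2 * v)]"
  shows "proper_biharmonic (sphere 0 1 \<times> sphere 0 1) (sphere 0 1) \<phi> \<longleftrightarrow>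
    l1\<^sup>2 + l2\<^sup>2 \<noteq> k1\<^sup>2 + k2\<^sup>2"
proof -
  have \<phi>: "\<phi> (tpoint s t) = wave k1 k2 l1 l2 1 1 s t" for s t
    by (simp add: tpoint_def assms wave_def clifford_def)
  have smooth: "smooth_map torus (sphere 0 1) \<phi>"
    using \<phi> by (rule smooth_map_wave)
  have "biharmonic torus (sphere 0 1) \<phi>"
    unfolding biharmonic_def using smooth bitension_wave[OF \<phi>] by (metis torus_cases)
  moreover have "harmonic torus (sphere 0 1) \<phi> \<longleftrightarrow>
      (real_of_int l1)\<^sup>2 + (real_of_int l2)\<^sup>2 = (real_of_int k1)\<^sup>2 + (real_of_int k2)\<^sup>2"
    unfolding harmonic_def using smooth tension_wave_eq_0_iff[OF \<phi>]
    by (metis torus_cases tpoint_in_torus)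
  moreover have "(real_of_int l1)\<^sup>2 + (real_of_int l2)\<^sup>2 = (real_of_int k1)\<^sup>2 + (real_of_int k2)\<^sup>2
      \<longleftrightarrow> l1\<^sup>2 + l2\<^sup>2 = k1\<^sup>2 + k2\<^sup>2"
    by (metis of_int_add of_int_eq_iff of_int_power)
  ultimately show ?thesis
    by (simp add: proper_biharmonic_def)
qed

end
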